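(* Consider a sequence of two-block multilayer stochastic block models indexed by a scale parameter $\nu=1,2,\dots$, where the number of nodes $N=N_\nu$, the number of layers $T=T_\nu$, the intra-block link probabilities $p_1,\dots,p_T\in[0,1]$, and the inter-block link probabilities $q_1,\dots,q_T\in[0,1]$ may all depend on $\nu$. Let $I_T=\sum_{t=1}^T I(p_t,q_t)$. Assume that $I_T\gg N^{-1}$, that is, $N I_T\to\infty$ as $\nu\to\infty$. For each $\nu$ let $z=z_\nu\in\mathcal{Z}$ be an arbitrary block structure, and let $\Pi=\Pi_\nu$ be the uniform prior on the set $\mathcal{Z}=\mathcal{Z}_\nu$ of all block structures. Then the posterior distribution almost exactly recovers $z$: for every constant $\epsilon>0$ not depending on $\nu$, $$\operatorname{Err}_z(\epsilon N)\to 0\qquad\text{as }\nu\to\infty .$$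
   Context: Notation: $[n]=\{1,\dots,n\}$. Model (for fixed $\nu$). There are $K=2$ blocks. The set of block structures is $\mathcal{Z}=\{z:[N]\to[2]\}$. The observation space $\mathfrak{X}$ is the set of all $X:[N]\times[N]\times[T]\to\{0,1\}$, written $X^{(t)}_{ij}$, such that $X^{(t)}_{ij}=X^{(t)}_{ji}$ and $X^{(t)}_{ii}=0$ for all $i,j,t$. Given $z\in\mathcal{Z}$, the observation has the probability mass function $$P_z(X)=\prod_{1\le i<j\le N}\prod_{t=1}^T \mathrm{Ber}_{Q^{(t)}_{z(i)z(j)}}\big(X^{(t)}_{ij}\big),\qquad X\in\mathfrak{X},$$ where $\mathrm{Ber}_p(x)=(1-p)^{1-x}p^x$ for $x\in\{0,1\}$, and $Q^{(t)}_{ab}=p_t$ if $a=b$ and $Q^{(t)}_{ab}=q_t$ if $a\ne b$. Rényi divergence. $I(p,q)$ is the Rényi divergence of order $1/2$ between the Bernoulli distributions with means $p$ and $q$: $$I(p,q)=-2\log\Big((1-p)^{1/2}(1-q)^{1/2}+p^{1/2}q^{1/2}\Big)\in[0,\infty].$$ Posterior. For a prior probability distribution $\Pi$ on $\mathcal{Z}$ and an observation $X\in\mathfrak{X}$, the posterior is $$\Pi_X(w)=\frac{\Pi(w)P_w(X)}{\sum_{w'\in\mathcal{Z}}\Pi(w')P_{w'}(X)},\qquad w\in\mathcal{Z}.$$ Error. The Hamming distance is $\operatorname{Ham}(w,z)=\#\{i\in[N]: w(i)\ne z(i)\}$. The absolute classification error is $d_{\mathrm{ACE}}(w,z)=\min\{\operatorname{Ham}(w,z),\operatorname{Ham}(w,\tilde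 z)\}$, where $\tilde z$ is obtained from $z$ by swapping the labels $1$ and $2$. For $r\ge 0$, $$\operatorname{Err}_z(r)=\sum_{X\in\mathfrak{X}}P_z(X)\,\Pi_X\big(\{w\in\mathcal{Z}: d_{\mathrm{ACE}}(w,z)>r\}\big),$$ i.e. the expected posterior mass of $\{w: d_{\mathrm{ACE}}(w,z)>r\}$ when $X$ is sampled from $P_z$. *)

theory Defs
  imports "HOL-Probability.Probability"
begin

text \<open>
  Block structures are functions on \<open>{1..N}\<close> with labels in \<open>{1, 2}\<close>, and observations are
  functions on index triples \<open>(i, j, t)\<close>. Both are taken in extensional form, so that each
  mathematical function is represented by exactly one HOL function and both spaces are finite.
\<close>

type_synonym block_structure = "nat \<Rightarrow> nat"
type_synonym observation = "nat \<times> nat \<times> nat \<Rightarrow> nat"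

definition block_structures :: "nat \<Rightarrow> block_structure set" where
  "block_structures N = {1..N} \<rightarrow>\<^sub>E {1, 2}"

definition observations :: "nat \<Rightarrow> nat \<Rightarrow> observation set" where
  "observations N T = {X \<in> {1..N} \<times> {1..N} \<times> {1..T} \<rightarrow>\<^sub>E {0, 1}.
     \<forall>i\<in>{1..N}. \<forall>j\<in>{1..N}. \<forall>t\<in>{1..T}. X (i, j, t) = X (j, i, t) \<and> X (i, i, t) = 0}"

definition Ber :: "real \<Rightarrow> nat \<Rightarrow> real" where
  "Ber p x = (1 - p) ^ (1 - x) * p ^ x"

definition link_prob :: "(nat \<Rightarrow> real) \<Rightarrow> (nat \<Rightarrow> real) \<Rightarrow> nat \<Rightarrow> nat \<Rightarrow> nat \<Rightarrow> real" where
  "link_prob p q t a b = (if a = b then p t else q t)"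

definition likelihood ::
    "nat \<Rightarrow> nat \<Rightarrow> (nat \<Rightarrow> real) \<Rightarrow> (nat \<Rightarrow> real) \<Rightarrow> block_structure \<Rightarrow> observation \<Rightarrow> real" where
  "likelihood N T p q z X =
     (\<Prod>(i, j)\<in>{(i, j). 1 \<le> i \<and> i < j \<and> j \<le> N}. \<Prod>t\<in>{1..T}.
        Ber (link_prob p q t (z i) (z j)) (X (i, j, t)))"

text \<open>
  Renyi divergence of order 1/2 between Bernoulli distributions. The logarithm's argument vanishes
  when the two distributions are mutually singular; the divergence is then infinite, whereas
  \<open>ln 0 = 0\<close> in HOL.
\<close>

definition renyi_half :: "real \<Rightarrow> real \<Rightarrow> ereal" where
  "renyi_half p q =
     (let a = sqrt (1 - p) * sqrt (1 - q) + sqrt p * sqrt q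
      in if a = 0 then \<infinity> else ereal (- 2 * ln a))"

definition total_divergence :: "nat \<Rightarrow> (nat \<Rightarrow> real) \<Rightarrow> (nat \<Rightarrow> real) \<Rightarrow> ereal" where
  "total_divergence T p q = (\<Sum>t\<in>{1..T}. renyi_half (p t) (q t))"

text \<open>
  When the evidence in the denominator is zero the quotient is zero. Such observations have
  likelihood zero under every block structure charged by the prior.
\<close>

definition posterior ::
    "nat \<Rightarrow> nat \<Rightarrow> (nat \<Rightarrow> real) \<Rightarrow> (nat \<Rightarrow> real) \<Rightarrow> block_structure pmf \<Rightarrow> observation \<Rightarrow>
     block_structure \<Rightarrow> real" where
  "posterior N T p q \<pi> X w =
     pmf \<pi> w * likelihood N T p q w X /
     (\<Sum>w'\<in>block_structures N. pmf \<pi> w' * likelihood N T p q w' X)"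

definition Ham :: "nat \<Rightarrow> block_structure \<Rightarrow> block_structure \<Rightarrow> nat" where
  "Ham N w z = card {i \<in> {1..N}. w i \<noteq> z i}"

definition swap_labels :: "nat \<Rightarrow> block_structure \<Rightarrow> block_structure" where
  "swap_labels N z = (\<lambda>i\<in>{1..N}. if z i = 1 then 2 else 1)"

definition d_ACE :: "nat \<Rightarrow> block_structure \<Rightarrow> block_structure \<Rightarrow> nat" where
  "d_ACE N w z = min (Ham N w z) (Ham N w (swap_labels N z))"

definition Err ::
    "nat \<Rightarrow> nat \<Rightarrow> (nat \<Rightarrow> real) \<Rightarrow> (nat \<Rightarrow> real) \<Rightarrow> block_structure pmf \<Rightarrow>
     block_structure \<Rightarrow> real \<Rightarrow> real" where
  "Err N T p q \<pi> z r =
     (\<Sum>X\<in>observations N T. likelihood N T p q z X *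
        (\<Sum>w | w \<in> block_structures N \<and> real (d_ACE N w z) > r. posterior N T p q \<pi> X w))"

end

theory Submission
  imports Defs
begin

text \<open>
  Telling \<open>z\<close> from a single competitor \<open>w\<close> is a two-point testing problem, and its error is
  controlled by the Hellinger affinity of \<open>P\<^sub>z\<close> and \<open>P\<^sub>w\<close>. The posterior
  denominator of the uniform prior contains both \<open>P\<^sub>z(X)\<close> and \<open>P\<^sub>w(X)\<close>, so it is at least their
  geometric mean, and the expected posterior mass of \<open>w\<close> is at most \<open>\<Sum>X. sqrt (P\<^sub>z(X) P\<^sub>w(X))\<close>
  (\<open>likelihood_mult_posterior_le\<close>). The entries of \<open>X\<close> above the diagonal are independent, so this
  sum factorises over vertex pairs and layers. A pair on which \<open>z\<close> and \<open>w\<close> agree about "same block"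
  contributes the factor 1; every other pair contributes
  \<open>A = \<Prod>t. (sqrt (1 - p\<^sub>t) sqrt (1 - q\<^sub>t) + sqrt p\<^sub>t sqrt q\<^sub>t) = exp (- I\<^sub>T / 2)\<close>
  (\<open>sum_sqrt_likelihood_le\<close>).

  If \<open>w\<close> and \<open>z\<close> differ at \<open>n\<close> vertices, they disagree on \<open>n (N - n)\<close> pairs, and \<open>N - n\<close> is the
  distance from \<open>w\<close> to the relabelled \<open>z\<close>. The larger of \<open>n\<close> and \<open>N - n\<close> is at least \<open>N / 2\<close>; the
  smaller is \<open>d\<^sub>A\<^sub>C\<^sub>E(w, z)\<close>. So an error above \<open>\<epsilon> N\<close> forces at least \<open>\<epsilon> N\<^sup>2 / 2\<close> mismatched pairs
  (\<open>card_mismatched_pairs_ge\<close>). The number of mismatched pairs is quadratic in \<open>N\<close> whereas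
  the number of competitors is only \<open>2\<^sup>N\<close>, so a crude union bound suffices (\<open>Err_uniform_le\<close>):
  the error is at most \<open>(2 (A\<^sup>N)\<^sup>\<epsilon>\<^sup>/\<^sup>2)\<^sup>N\<close>.
  The hypothesis \<open>N I\<^sub>T \<rightarrow> \<infinity>\<close> says exactly that \<open>A\<^sup>N = exp (- N I\<^sub>T / 2)\<close> tends to 0. Hence the
  base of the power tends to 0. Since eventually \<open>N \<ge> 1\<close>, the power is then at most its base, and
  the argument covers bounded \<open>N\<close> as well as \<open>N \<rightarrow> \<infinity>\<close>.
\<close>

section \<open>Affinities of Bernoulli distributions\<close>

definition vertex_pairs :: "nat \<Rightarrow> (nat \<times> nat) set" where
  "vertex_pairs N = {(i, j). 1 \<le> i \<and> i < j \<and> j \<le> N}"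

text \<open>
  This is the Hellinger affinity (Bhattacharyya coefficient) of two Bernoulli distributions, whose
  logarithm appears in the Renyi divergence of order 1/2.
\<close>
definition affinity :: "real \<Rightarrow> real \<Rightarrow> real" where
  "affinity p q = sqrt (1 - p) * sqrt (1 - q) + sqrt p * sqrt q"

definition layer_affinity :: "nat \<Rightarrow> (nat \<Rightarrow> real) \<Rightarrow> (nat \<Rightarrow> real) \<Rightarrow> real" where
  "layer_affinity T p q = (\<Prod>t\<in>{1..T}. affinity (p t) (q t))"

lemma finite_vertex_pairs: "finite (vertex_pairs N)"
  by (rule finite_subset[of _ "{1..N} \<times> {1..N}"]) (auto simp: vertex_pairs_def)

lemma affinity_commute: "affinity p q = affinity q p"
  by (simp add: affinity_def mult.commute)

lemma affinity_self: "p \<in> {0..1} \<Longrightarrow> affinity p p = 1"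
  by (simp add: affinity_def)

lemma affinity_nonneg: "p \<in> {0..1} \<Longrightarrow> q \<in> {0..1} \<Longrightarrow> 0 \<le> affinity p q"
  by (simp add: affinity_def)

lemma affinity_le_1:
  assumes "p \<in> {0..1}" "q \<in> {0..1}"
  shows "affinity p q \<le> 1"
proof -
  have "sqrt (1 - p) * sqrt (1 - q) \<le> ((1 - p) + (1 - q)) / 2"
    using arith_geo_mean_sqrt[of "1 - p" "1 - q"] assms by (simp add: real_sqrt_mult)
  moreover have "sqrt p * sqrt q \<le> (p + q) / 2"
    using arith_geo_mean_sqrt[of p q] assms by (simp add: real_sqrt_mult)
  ultimately show ?thesis
    by (simp add: affinity_def field_simps)
qed

lemma sum_sqrt_Ber: "(\<Sum>x\<in>{0, 1}. sqrt (Ber p x * Ber q x)) = affinity p q"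
  by (simp add: Ber_def affinity_def real_sqrt_mult)

lemma Ber_nonneg: "p \<in> {0..1} \<Longrightarrow> 0 \<le> Ber p x"
  by (simp add: Ber_def)

lemma link_prob_in_unit:
  "p t \<in> {0..1} \<Longrightarrow> q t \<in> {0..1} \<Longrightarrow> link_prob p q t a b \<in> {0..1}"
  by (simp add: link_prob_def)

lemma sqrt_prod: "sqrt (\<Prod>k\<in>A. f k) = (\<Prod>k\<in>A. sqrt (f k))"
  by (induction A rule: infinite_finite_induct) (simp_all add: real_sqrt_mult)

section \<open>Affinities of observation distributions\<close>

lemma prod_pairs_layers:
  "(\<Prod>(i, j)\<in>A. \<Prod>t\<in>B. f i j t) = (\<Prod>((i, j), t)\<in>A \<times> B. f i j t)"
  using prod.cartesian_product[of "\<lambda>e t. f (fst e) (snd e) t" B A] by (simp add: case_prod_unfold)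

lemma likelihood_eq_prod:
  "likelihood N T p q z X =
     (\<Prod>((i, j), t)\<in>vertex_pairs N \<times> {1..T}. Ber (link_prob p q t (z i) (z j)) (X (i, j, t)))"
  unfolding likelihood_def vertex_pairs_def[symmetric] by (rule prod_pairs_layers)

lemma finite_block_structures: "finite (block_structures N)"
  by (auto simp: block_structures_def intro!: finite_PiE)

lemma card_block_structures: "card (block_structures N) = 2 ^ N"
  by (simp add: block_structures_def card_PiE numeral_2_eq_2)

text \<open>
  An observation is symmetric with zero diagonal, so its entries above the diagonal determine it.
\<close>
lemma inj_on_upper_entries:
  "inj_on (\<lambda>X. \<lambda>((i, j), t)\<in>vertex_pairs N \<times> {1..T}. X (i, j, t)) (observations N T)"
  (is "inj_on ?u _")
proof (rule inj_onI)
  fix X Y assume X: "X \<in> observations N T" and Y: "Y \<in> observations N T" and eq: "?u X = ?u Y"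
  have upper: "X (i, j, t) = Y (i, j, t)" if "i \<in> {1..N}" "j \<in> {1..N}" "t \<in> {1..T}" "i < j" for i j t
    using fun_cong[OF eq, of "((i, j), t)"] that by (simp add: vertex_pairs_def)
  have all: "X (i, j, t) = Y (i, j, t)" if ijt: "i \<in> {1..N}" "j \<in> {1..N}" "t \<in> {1..T}" for i j t
  proof (cases i j rule: linorder_cases)
    case less
    then show ?thesis using upper ijt by blast
  next
    case equal
    then show ?thesis using X Y ijt by (simp add: observations_def)
  next
    case greater
    have "X (i, j, t) = X (j, i, t)" "Y (i, j, t) = Y (j, i, t)"
      using X Y ijt unfolding observations_def by blast+
    then show ?thesis using upper[of j i t] ijt greater by simp
  qed
  show "X = Y"
  proof (rule PiE_ext)
    show "X \<in> {1..N} \<times> {1..N} \<times> {1..T} \<rightarrow>\<^sub>E {0, 1}" "Y \<in> {1..N} \<times> {1..N} \<times> {1..T} \<rightarrow>\<^sub>E {0, 1}"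
      using X Y by (simp_all add: observations_def)
  qed (use all in auto)
qed

definition mismatched_pairs ::
    "nat \<Rightarrow> block_structure \<Rightarrow> block_structure \<Rightarrow> (nat \<times> nat) set" where
  "mismatched_pairs N w z = {(i, j)\<in>vertex_pairs N. (w i = w j) \<noteq> (z i = z j)}"

text \<open>
  A pair classified alike by \<open>z\<close> and \<open>w\<close> has the same link probabilities under both, hence affinity
  1. On a mismatched pair one structure uses \<open>p\<close> and the other \<open>q\<close>, in an order that does not matter
  because the affinity is symmetric.
\<close>
lemma prod_affinity_eq_power:
  assumes p: "\<And>t. t \<in> {1..T} \<Longrightarrow> p t \<in> {0..1}" and q: "\<And>t. t \<in> {1..T} \<Longrightarrow> q t \<in> {0..1}"
  shows "(\<Prod>(i, j)\<in>vertex_pairs N. \<Prod>t\<in>{1..T}.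
          affinity (link_prob p q t (z i) (z j)) (link_prob p q t (w i) (w j)))
    = layer_affinity T p q ^ card (mismatched_pairs N w z)"
proof -
  have "(\<Prod>(i, j)\<in>vertex_pairs N. \<Prod>t\<in>{1..T}.
          affinity (link_prob p q t (z i) (z j)) (link_prob p q t (w i) (w j)))
    = (\<Prod>e\<in>vertex_pairs N. if e \<in> mismatched_pairs N w z then layer_affinity T p q else 1)"
  proof (intro prod.cong refl, clarify)
    fix i j assume ij: "(i, j) \<in> vertex_pairs N"
    show "(\<Prod>t\<in>{1..T}. affinity (link_prob p q t (z i) (z j)) (link_prob p q t (w i) (w j)))
      = (if (i, j) \<in> mismatched_pairs N w z then layer_affinity T p q else 1)"
    proof (cases "(i, j) \<in> mismatched_pairs N w z")
      case True
      then have "affinity (link_prob p q t (z i) (z j)) (link_prob p q t (w i) (w j))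
          = affinity (p t) (q t)" for t
        by (auto simp: mismatched_pairs_def link_prob_def affinity_commute)
      then show ?thesis using True by (simp add: layer_affinity_def)
    next
      case False
      then have same: "(w i = w j) = (z i = z j)"
        using ij by (simp add: mismatched_pairs_def)
      have "affinity (link_prob p q t (z i) (z j)) (link_prob p q t (w i) (w j)) = 1"
        if "t \<in> {1..T}" for t
        using p[OF that] q[OF that] affinity_self[of "p t"] affinity_self[of "q t"]
        by (simp add: link_prob_def same)
      then show ?thesis using False by simp
    qed
  qed
  also have "\<dots> = (\<Prod>e\<in>mismatched_pairs N w z. layer_affinity T p q)"
    by (rule prod.mono_neutral_cong_right) (auto simp: finite_vertex_pairs mismatched_pairs_def)
  finally show ?thesis by simp
qed

text \<open>
  Exchanging sum and product, the entries above the diagonal range independently over \<open>{0, 1}\<close> and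
  each contributes the affinity of its two Bernoulli laws. The bound is in fact attained, but an
  inequality only requires observations to be embedded into, rather than identified with, the
  functions on upper entries.
\<close>
lemma sum_sqrt_likelihood_le:
  assumes p: "\<And>t. t \<in> {1..T} \<Longrightarrow> p t \<in> {0..1}" and q: "\<And>t. t \<in> {1..T} \<Longrightarrow> q t \<in> {0..1}"
  shows "(\<Sum>X\<in>observations N T. sqrt (likelihood N T p q z X * likelihood N T p q w X))
    \<le> layer_affinity T p q ^ card (mismatched_pairs N w z)"
proof -
  define E where "E = vertex_pairs N \<times> {1..T}"
  define P where "P v k = (case k of ((i, j), t) \<Rightarrow> link_prob p q t (v i) (v j))"
    for v :: block_structure and k
  define u where "u X = (\<lambda>((i, j), t)\<in>E. X (i, j, t))" for X :: observation
  define g where "g k x = sqrt (Ber (P z k) x * Ber (P w k) x)" for k x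
  have finE: "finite E" by (simp add: E_def finite_vertex_pairs)
  have P_unit: "P v k \<in> {0..1}" if "k \<in> E" for v k
    using that p q by (auto simp: E_def P_def link_prob_def)
  have lik: "likelihood N T p q v X = (\<Prod>k\<in>E. Ber (P v k) (u X k))" for v X
    unfolding likelihood_eq_prod E_def[symmetric] by (rule prod.cong) (auto simp: P_def u_def)
  have "sqrt (likelihood N T p q z X * likelihood N T p q w X) = (\<Prod>k\<in>E. g k (u X k))" for X
    unfolding lik g_def prod.distrib[symmetric] by (rule sqrt_prod)
  then have "(\<Sum>X\<in>observations N T. sqrt (likelihood N T p q z X * likelihood N T p q w X))
      = (\<Sum>X\<in>observations N T. \<Prod>k\<in>E. g k (u X k))"
    by simp
  also have "\<dots> = (\<Sum>Y\<in>u ` observations N T. \<Prod>k\<in>E. g k (Y k))"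
    using inj_on_upper_entries[of N T] unfolding u_def E_def by (subst sum.reindex) auto
  also have "\<dots> \<le> (\<Sum>Y\<in>E \<rightarrow>\<^sub>E {0, 1}. \<Prod>k\<in>E. g k (Y k))"
  proof (rule sum_mono2)
    show "finite (E \<rightarrow>\<^sub>E {0, 1 :: nat})" using finE by (intro finite_PiE) auto
    show "u ` observations N T \<subseteq> E \<rightarrow>\<^sub>E {0, 1}"
    proof (rule image_subsetI)
      fix X assume "X \<in> observations N T"
      then have X: "X \<in> {1..N} \<times> {1..N} \<times> {1..T} \<rightarrow>\<^sub>E {0, 1}" by (simp add: observations_def)
      have "u X k \<in> {0, 1}" if "k \<in> E" for k
        using that PiE_mem[OF X, of "(fst (fst k), snd (fst k), snd k)"]
        by (auto simp: u_def E_def vertex_pairs_def)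
      then show "u X \<in> E \<rightarrow>\<^sub>E {0, 1}" by (simp add: PiE_iff u_def)
    qed
    show "0 \<le> (\<Prod>k\<in>E. g k (Y k))" for Y
      using P_unit by (intro prod_nonneg ballI) (simp add: g_def Ber_nonneg)
  qed
  also have "\<dots> = (\<Prod>k\<in>E. \<Sum>x\<in>{0, 1}. g k x)"
    by (rule prod_sum_PiE[symmetric]) (use finE in auto)
  also have "\<dots> = (\<Prod>k\<in>E. affinity (P z k) (P w k))"
    unfolding g_def sum_sqrt_Ber ..
  also have "\<dots> = (\<Prod>(i, j)\<in>vertex_pairs N. \<Prod>t\<in>{1..T}.
          affinity (link_prob p q t (z i) (z j)) (link_prob p q t (w i) (w j)))"
    unfolding E_def prod_pairs_layers by (rule prod.cong) (auto simp: P_def)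
  also have "\<dots> = layer_affinity T p q ^ card (mismatched_pairs N w z)"
    using p q by (rule prod_affinity_eq_power)
  finally show ?thesis .
qed

lemma layer_affinity_bounds:
  assumes p: "\<And>t. t \<in> {1..T} \<Longrightarrow> p t \<in> {0..1}" and q: "\<And>t. t \<in> {1..T} \<Longrightarrow> q t \<in> {0..1}"
  shows "0 \<le> layer_affinity T p q" "layer_affinity T p q \<le> 1"
  unfolding layer_affinity_def using p q
  by (auto intro!: prod_nonneg prod_le_1 affinity_nonneg affinity_le_1)

section \<open>Counting mismatched pairs\<close>

lemma neq_swap_labels_iff:
  assumes "w \<in> block_structures N" "z \<in> block_structures N" "i \<in> {1..N}"
  shows "w i \<noteq> swap_labels N z i \<longleftrightarrow> w i = z i"
proof -
  have "w i \<in> {1, 2}" "z i \<in> {1, 2}"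
    using assms PiE_mem unfolding block_structures_def by blast+
  then show ?thesis using assms(3) by (auto simp: swap_labels_def)
qed

lemma Ham_add_Ham_swap_labels:
  assumes "w \<in> block_structures N" "z \<in> block_structures N"
  shows "Ham N w z + Ham N w (swap_labels N z) = N"
proof -
  define D where "D = {i \<in> {1..N}. w i \<noteq> z i}"
  have D: "D \<subseteq> {1..N}" "finite D" by (auto simp: D_def)
  have "{i \<in> {1..N}. w i \<noteq> swap_labels N z i} = {1..N} - D"
    unfolding D_def using neq_swap_labels_iff[OF assms] by blast
  moreover have "card ({1..N} - D) = N - card D" "card D \<le> N"
    using card_Diff_subset[of D "{1..N}"] card_mono[of "{1..N}" D] D by simp_all
  ultimately show ?thesis unfolding Ham_def D_def[symmetric] by simp
qed

text \<open>
  With only two labels, a vertex where \<open>w\<close> and \<open>z\<close> differ paired with one where they coincide is always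
  a mismatched pair: flipping one endpoint of a pair flips whether its labels are equal.
\<close>
lemma Ham_mult_Ham_swap_labels_le:
  assumes w: "w \<in> block_structures N" and z: "z \<in> block_structures N"
  shows "Ham N w z * Ham N w (swap_labels N z) \<le> card (mismatched_pairs N w z)"
proof -
  define D where "D = {i \<in> {1..N}. w i \<noteq> z i}"
  define C where "C = {i \<in> {1..N}. w i \<noteq> swap_labels N z i}"
  define f where "f = (\<lambda>(i :: nat, j). (min i j, max i j))"
  have C: "C = {i \<in> {1..N}. w i = z i}"
    unfolding C_def using neq_swap_labels_iff[OF w z] by blast
  have lab: "v i = 1 \<or> v i = 2" if "v \<in> block_structures N" "i \<in> {1..N}" for v i
    using that by (auto simp: block_structures_def PiE_iff)
  \<comment> \<open>Sorting a pair loses nothing here, since its members lie in disjoint sets.\<close>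
  have "inj_on f (D \<times> C)"
    by (auto simp: inj_on_def f_def D_def C min_def max_def split: if_splits)
  moreover have "f ` (D \<times> C) \<subseteq> mismatched_pairs N w z"
  proof (rule image_subsetI)
    fix e assume "e \<in> D \<times> C"
    then obtain i j where e: "e = (i, j)"
      and ij: "i \<in> {1..N}" "j \<in> {1..N}" "w i \<noteq> z i" "w j = z j"
      by (auto simp: D_def C)
    have mis: "(w i = w j) \<noteq> (z i = z j)"
      using lab[OF w ij(1)] lab[OF z ij(1)] lab[OF w ij(2)] ij(3,4) by auto
    consider "i < j" | "j < i" using ij(3,4) by (metis nat_neq_iff)
    then show "f e \<in> mismatched_pairs N w z"
    proof cases
      case 1
      then show ?thesis
        using ij(1,2) mis by (simp add: e f_def mismatched_pairs_def vertex_pairs_def)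
    next
      case 2
      have "(w j = w i) \<noteq> (z j = z i)" using mis by metis
      then show ?thesis
        using 2 ij(1,2) by (simp add: e f_def mismatched_pairs_def vertex_pairs_def)
    qed
  qed
  moreover have "finite (mismatched_pairs N w z)"
    using finite_vertex_pairs by (rule rev_finite_subset) (auto simp: mismatched_pairs_def)
  ultimately have "card (D \<times> C) \<le> card (mismatched_pairs N w z)"
    by (metis card_image card_mono)
  then show ?thesis by (simp add: card_cartesian_product Ham_def D_def C_def)
qed

text \<open>
  Since \<open>d_ACE\<close> is the smaller of two distances adding up to \<open>N\<close>, the larger one is at least \<open>N / 2\<close>.
\<close>
lemma card_mismatched_pairs_ge:
  assumes w: "w \<in> block_structures N" and z: "z \<in> block_structures N"
  shows "real (d_ACE N w z) * real N / 2 \<le> real (card (mismatched_pairs N w z))"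
proof -
  define a b where "a = Ham N w z" and "b = Ham N w (swap_labels N z)"
  have ab: "a + b = N" using Ham_add_Ham_swap_labels[OF w z] by (simp add: a_def b_def)
  have "min a b * N \<le> min a b * (2 * max a b)"
    using ab by (intro mult_left_mono) auto
  also have "\<dots> = 2 * (a * b)" by (simp add: min_def max_def)
  also have "\<dots> \<le> 2 * card (mismatched_pairs N w z)"
    using Ham_mult_Ham_swap_labels_le[OF w z] by (simp add: a_def b_def)
  finally have "real (min a b * N) \<le> real (2 * card (mismatched_pairs N w z))"
    by (simp only: of_nat_le_iff)
  then show ?thesis by (simp add: d_ACE_def a_def b_def)
qed

section \<open>Posterior error under the uniform prior\<close>

lemma likelihood_nonneg:
  assumes p: "\<And>t. t \<in> {1..T} \<Longrightarrow> p t \<in> {0..1}" and q: "\<And>t. t \<in> {1..T} \<Longrightarrow> q t \<in> {0..1}"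
  shows "0 \<le> likelihood N T p q z X"
  unfolding likelihood_def using p q
  by (auto intro!: prod_nonneg Ber_nonneg link_prob_in_unit)

lemma posterior_uniform:
  assumes "w \<in> block_structures N"
  shows "posterior N T p q (pmf_of_set (block_structures N)) X w
    = likelihood N T p q w X / (\<Sum>v\<in>block_structures N. likelihood N T p q v X)"
proof -
  have ne: "block_structures N \<noteq> {}" using assms by blast
  have c: "real (card (block_structures N)) \<noteq> 0"
    by (simp add: card_block_structures)
  show ?thesis
    using c assms unfolding posterior_def
    by (simp add: pmf_of_set[OF ne finite_block_structures] sum_divide_distrib[symmetric])
qed

text \<open>
  The evidence \<open>S\<close> dominates both likelihoods, so \<open>L z * L w = (sqrt (L z * L w))\<^sup>2 \<le> S * sqrt (L z * L w)\<close>.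
\<close>
lemma likelihood_mult_posterior_le:
  assumes p: "\<And>t. t \<in> {1..T} \<Longrightarrow> p t \<in> {0..1}" and q: "\<And>t. t \<in> {1..T} \<Longrightarrow> q t \<in> {0..1}"
    and z: "z \<in> block_structures N" and w: "w \<in> block_structures N"
  shows "likelihood N T p q z X * posterior N T p q (pmf_of_set (block_structures N)) X w
    \<le> sqrt (likelihood N T p q z X * likelihood N T p q w X)"
proof -
  define L where "L v = likelihood N T p q v X" for v
  define S where "S = (\<Sum>v\<in>block_structures N. L v)"
  have L0: "0 \<le> L v" for v unfolding L_def by (rule likelihood_nonneg[OF p q])
  have LS: "L v \<le> S" if "v \<in> block_structures N" for v
    unfolding S_def using that L0 finite_block_structures by (intro member_le_sum) auto
  have S0: "0 \<le> S" using L0 by (simp add: S_def sum_nonneg)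
  have "sqrt (L z * L w) \<le> S"
    using LS[OF z] LS[OF w] L0 S0
    by (intro real_le_lsqrt) (auto simp: power2_eq_square intro: mult_mono)
  then have "sqrt (L z * L w) * sqrt (L z * L w) \<le> sqrt (L z * L w) * S"
    using L0 by (intro mult_left_mono) auto
  then have "L z * L w \<le> sqrt (L z * L w) * S"
    using L0 by simp
  then have "L z * L w / S \<le> sqrt (L z * L w)"
    using S0 L0 by (cases "S = 0") (simp_all add: divide_le_eq)
  then show ?thesis
    using posterior_uniform[OF w] by (simp add: L_def S_def)
qed

text \<open>
  A union bound over all \<open>2 ^ N\<close> block structures, written as a single \<open>N\<close>-th power whose base depends
  on the affinity only through \<open>layer_affinity T p q ^ N\<close>, that is, through \<open>N I\<^sub>T\<close>.
\<close>
lemma Err_uniform_le: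
  assumes p: "\<And>t. t \<in> {1..T} \<Longrightarrow> p t \<in> {0..1}" and q: "\<And>t. t \<in> {1..T} \<Longrightarrow> q t \<in> {0..1}"
    and z: "z \<in> block_structures N" and N: "0 < N" and \<epsilon>: "0 < \<epsilon>"
  shows "Err N T p q (pmf_of_set (block_structures N)) z (\<epsilon> * real N)
    \<le> (2 * (layer_affinity T p q ^ N) powr (\<epsilon> / 2)) ^ N"
proof -
  define A where "A = layer_affinity T p q"
  define W where "W = {w \<in> block_structures N. \<epsilon> * real N < real (d_ACE N w z)}"
  define L where "L v X = likelihood N T p q v X" for v X
  define post where "post = posterior N T p q (pmf_of_set (block_structures N))"
  have A: "0 \<le> A" "A \<le> 1"
    using layer_affinity_bounds[of T p q] p q by (simp_all add: A_def)
  have W: "W \<subseteq> block_structures N" by (auto simp: W_def)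
  have each: "(\<Sum>X\<in>observations N T. L z X * post X w) \<le> ((A ^ N) powr (\<epsilon> / 2)) ^ N"
    if w: "w \<in> W" for w
  proof -
    define m where "m = card (mismatched_pairs N w z)"
    have wB: "w \<in> block_structures N" using w W by blast
    have m: "\<epsilon> * real N * real N / 2 \<le> real m"
    proof -
      have "\<epsilon> * real N * real N / 2 \<le> real (d_ACE N w z) * real N / 2"
        using w by (intro divide_right_mono mult_right_mono) (auto simp: W_def)
      then show ?thesis using card_mismatched_pairs_ge[OF wB z] by (simp add: m_def)
    qed
    \<comment> \<open>When the affinity is 0, a single mismatched pair makes \<open>w\<close> incompatible with the data.\<close>
    have m0: "0 < m"
    proof -
      have "0 < \<epsilon> * real N * real N / 2" using \<epsilon> N by simp
      then show ?thesis using m by simp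
    qed
    have "(\<Sum>X\<in>observations N T. L z X * post X w) \<le> (\<Sum>X\<in>observations N T. sqrt (L z X * L w X))"
      unfolding L_def post_def using p q z wB by (intro sum_mono likelihood_mult_posterior_le) auto
    also have "\<dots> \<le> A ^ m"
      unfolding L_def A_def m_def using p q by (rule sum_sqrt_likelihood_le)
    also have "A ^ m \<le> ((A ^ N) powr (\<epsilon> / 2)) ^ N"
    proof (cases "A = 0")
      case True
      then show ?thesis using m0 by (simp add: zero_power)
    next
      case False
      then have "A > 0" using A by simp
      then have "A ^ m = A powr real m" by (simp add: powr_realpow)
      also have "\<dots> \<le> A powr (\<epsilon> * real N * real N / 2)"
        using \<open>A > 0\<close> A m by (intro powr_mono') auto
      also have "\<dots> = ((A ^ N) powr (\<epsilon> / 2)) ^ N"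
        using \<open>A > 0\<close> by (simp add: powr_realpow[symmetric] powr_powr mult_ac)
      finally show ?thesis .
    qed
    finally show ?thesis .
  qed
  have "Err N T p q (pmf_of_set (block_structures N)) z (\<epsilon> * real N)
      = (\<Sum>w\<in>W. \<Sum>X\<in>observations N T. L z X * post X w)"
    unfolding Err_def W_def L_def post_def sum_distrib_left by (rule sum.swap)
  also have "\<dots> \<le> (\<Sum>w\<in>W. ((A ^ N) powr (\<epsilon> / 2)) ^ N)"
    by (rule sum_mono) (rule each)
  also have "\<dots> \<le> (\<Sum>w\<in>block_structures N. ((A ^ N) powr (\<epsilon> / 2)) ^ N)"
    using W finite_block_structures by (intro sum_mono2) auto
  also have "\<dots> = (2 * (A ^ N) powr (\<epsilon> / 2)) ^ N"
    by (simp add: card_block_structures power_mult_distrib)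
  finally show ?thesis by (simp add: A_def)
qed

lemma Err_uniform_nonneg:
  assumes p: "\<And>t. t \<in> {1..T} \<Longrightarrow> p t \<in> {0..1}" and q: "\<And>t. t \<in> {1..T} \<Longrightarrow> q t \<in> {0..1}"
  shows "0 \<le> Err N T p q \<pi> z r"
  unfolding Err_def posterior_def
  by (intro sum_nonneg mult_nonneg_nonneg divide_nonneg_nonneg likelihood_nonneg[OF p q]) auto

section \<open>Almost exact recovery\<close>

text \<open>
  A nonzero product of affinities means that no layer separates the two laws perfectly, so every
  summand of the total divergence is finite.
\<close>
lemma total_divergence_eq:
  assumes "layer_affinity T p q \<noteq> 0"
  shows "total_divergence T p q = ereal (- 2 * ln (layer_affinity T p q))"
proof -
  have nz: "affinity (p t) (q t) \<noteq> 0" if "t \<in> {1..T}" for t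
    using assms that by (auto simp: layer_affinity_def)
  have "total_divergence T p q = (\<Sum>t\<in>{1..T}. ereal (- 2 * ln (affinity (p t) (q t))))"
    unfolding total_divergence_def
    by (rule sum.cong) (use nz in \<open>auto simp: renyi_half_def affinity_def Let_def\<close>)
  also have "\<dots> = ereal (- 2 * (\<Sum>t\<in>{1..T}. ln (affinity (p t) (q t))))"
    by (simp add: sum_distrib_left)
  also have "(\<Sum>t\<in>{1..T}. ln (affinity (p t) (q t))) = ln (layer_affinity T p q)"
    unfolding layer_affinity_def using nz by (subst ln_prod) auto
  finally show ?thesis .
qed

theorem theorem1:
  fixes N T :: "nat \<Rightarrow> nat"
    and p q :: "nat \<Rightarrow> nat \<Rightarrow> real"
    and z :: "nat \<Rightarrow> block_structure"
  assumes p: "\<And>\<nu> t. \<nu> \<ge> 1 \<Longrightarrow> t \<in> {1..T \<nu>} \<Longrightarrow> p \<nu> t \<in> {0..1}"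
    and q: "\<And>\<nu> t. \<nu> \<ge> 1 \<Longrightarrow> t \<in> {1..T \<nu>} \<Longrightarrow> q \<nu> t \<in> {0..1}"
    and z: "\<And>\<nu>. \<nu> \<ge> 1 \<Longrightarrow> z \<nu> \<in> block_structures (N \<nu>)"
    and I: "(\<lambda>\<nu>. ereal (real (N \<nu>)) * total_divergence (T \<nu>) (p \<nu>) (q \<nu>)) \<longlonglongrightarrow> \<infinity>"
  shows "\<forall>\<epsilon>>0. (\<lambda>\<nu>. Err (N \<nu>) (T \<nu>) (p \<nu>) (q \<nu>)
             (pmf_of_set (block_structures (N \<nu>))) (z \<nu>) (\<epsilon> * real (N \<nu>))) \<longlonglongrightarrow> 0"
proof (intro allI impI)
  fix \<epsilon> :: real assume \<epsilon>: "0 < \<epsilon>"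
  define A where "A \<nu> = layer_affinity (T \<nu>) (p \<nu>) (q \<nu>)" for \<nu>
  define b where "b \<nu> = 2 * (A \<nu> ^ N \<nu>) powr (\<epsilon> / 2)" for \<nu>
  have ev1: "\<forall>\<^sub>F \<nu> in sequentially. \<nu> \<ge> 1" by (rule eventually_ge_at_top)
  have A: "0 \<le> A \<nu>" if "\<nu> \<ge> 1" for \<nu>
    unfolding A_def using layer_affinity_bounds p q that by auto
  have large: "\<forall>\<^sub>F \<nu> in sequentially. ereal c < ereal (real (N \<nu>)) * total_divergence (T \<nu>) (p \<nu>) (q \<nu>)"
    for c
    using I by (simp add: tendsto_PInfty)
  \<comment> \<open>For \<open>N = 0\<close> the product \<open>N I\<^sub>T\<close> is 0, even when \<open>I\<^sub>T\<close> is infinite.\<close>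
  have evN: "\<forall>\<^sub>F \<nu> in sequentially. 0 < N \<nu>"
    using large[of 0]
  proof eventually_elim
    case (elim \<nu>)
    then have "N \<nu> \<noteq> 0" by (intro notI) (simp flip: zero_ereal_def)
    then show ?case by simp
  qed
  \<comment> \<open>Divergence of \<open>N I\<^sub>T\<close> is convergence of \<open>exp (- N I\<^sub>T / 2)\<close>, with infinite \<open>I\<^sub>T\<close> matching \<open>A = 0\<close>.\<close>
  have "(\<lambda>\<nu>. A \<nu> ^ N \<nu>) \<longlonglongrightarrow> 0"
  proof (rule order_tendstoI)
    fix c :: real assume c: "c < 0"
    show "\<forall>\<^sub>F \<nu> in sequentially. c < A \<nu> ^ N \<nu>"
      using ev1 by eventually_elim (rule less_le_trans[OF c zero_le_power[OF A]])
  next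
    fix c :: real assume c: "0 < c"
    show "\<forall>\<^sub>F \<nu> in sequentially. A \<nu> ^ N \<nu> < c"
      using ev1 evN large[of "- 2 * ln c"]
    proof eventually_elim
      case (elim \<nu>)
      show ?case
      proof (cases "A \<nu> = 0")
        case True
        then show ?thesis using c elim(2) by (simp add: zero_power)
      next
        case False
        then have pos: "0 < A \<nu>" using A[OF elim(1)] by simp
        have "- 2 * ln c < real (N \<nu>) * (- 2 * ln (A \<nu>))"
          using elim(3) False by (simp add: total_divergence_eq A_def)
        then have "ln (A \<nu> ^ N \<nu>) < ln c"
          using pos by (simp add: ln_realpow)
        then show ?thesis using pos c by simp
      qed
    qed
  qed
  moreover have "\<forall>\<^sub>F \<nu> in sequentially. 0 \<le> A \<nu> ^ N \<nu>"
    using ev1 by eventually_elim (intro zero_le_power A)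
  ultimately have "(\<lambda>\<nu>. 2 * (A \<nu> ^ N \<nu>) powr (\<epsilon> / 2)) \<longlonglongrightarrow> 2 * 0 powr (\<epsilon> / 2)"
    using \<epsilon> by (intro tendsto_mult tendsto_const tendsto_powr2) auto
  then have b: "b \<longlonglongrightarrow> 0" by (simp add: b_def[abs_def])
  show "(\<lambda>\<nu>. Err (N \<nu>) (T \<nu>) (p \<nu>) (q \<nu>)
           (pmf_of_set (block_structures (N \<nu>))) (z \<nu>) (\<epsilon> * real (N \<nu>))) \<longlonglongrightarrow> 0"
  proof (rule tendsto_sandwich[OF _ _ tendsto_const b])
    show "\<forall>\<^sub>F \<nu> in sequentially. 0 \<le> Err (N \<nu>) (T \<nu>) (p \<nu>) (q \<nu>)
           (pmf_of_set (block_structures (N \<nu>))) (z \<nu>) (\<epsilon> * real (N \<nu>))"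
      using ev1 by eventually_elim (rule Err_uniform_nonneg[OF p q])
    have "\<forall>\<^sub>F \<nu> in sequentially. b \<nu> < 1"
      using order_tendstoD(2)[OF b] by simp
    then show "\<forall>\<^sub>F \<nu> in sequentially. Err (N \<nu>) (T \<nu>) (p \<nu>) (q \<nu>)
           (pmf_of_set (block_structures (N \<nu>))) (z \<nu>) (\<epsilon> * real (N \<nu>)) \<le> b \<nu>"
      using ev1 evN
    proof eventually_elim
      case (elim \<nu>)
      have "Err (N \<nu>) (T \<nu>) (p \<nu>) (q \<nu>)
           (pmf_of_set (block_structures (N \<nu>))) (z \<nu>) (\<epsilon> * real (N \<nu>)) \<le> b \<nu> ^ N \<nu>"
        unfolding b_def A_def
        by (rule Err_uniform_le[OF p[OF elim(2)] q[OF elim(2)] z[OF elim(2)] elim(3) \<epsilon>])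
      also have "\<dots> \<le> b \<nu> ^ 1"
      proof (rule power_decreasing)
        show "0 \<le> b \<nu>" by (simp add: b_def)
      qed (use elim in auto)
      finally show ?case by simp
    qed
  qed
qed

end
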